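(* Let $X$ be a proper CAT(0) space and let $\partial X$ be its visual boundary. Let $\zeta,\eta\in\partial X$ be two distinct points, where $\zeta=c(\infty)$ for some sublinearly contracting geodesic ray $c$. Then there is a geodesic line $l:(-\infty,\infty)\to X$ with $l(-\infty)=\zeta$ and $l(\infty)=\eta$. That is, sublinearly contracting geodesic rays define visibility points in $\partial X$.
   Context: A sublinear function is a function $\kappa:[0,\infty)\to[1,\infty)$ that is monotone increasing, concave, and satisfies $\lim_{t\to\infty}\kappa(t)/t=0$. For a geodesic ray $b$ in $X$ let $\pi_b:X\to b$ denote the nearest point projection onto (the image of) $b$. The ray $b$ is $\kappa$-contracting if there is a constant $\mathsf{n}\ge 0$ such that for every ball $B$ centered at a point $x\in X$ with $B\cap b=\emptyset$ one has $\operatorname{diam}(\pi_b(B))\le \mathsf{n}\,\kappa(\|x\|)$, where $\|x\|=d(x,b(0))$. It is sublinearly contracting if it is $\kappa$-contracting for some sublinear function $\kappa$. The visual boundary $\partial X$ is the set of geodesic rays modulo the relation of staying at bounded distance; the class of $b$ is written $b(\infty)$. For a geodesic line $l$, $l(\infty)$ and $l(-\infty)$ denote the classes of the rays $t\mapsto l(t)$ and $t\mapsto l(-t)$, $t\ge0$. A point $\zeta\in\partial X$ is a visibility point if for every $\eta\in\partial X$ with $\eta\ne\zeta$ there is a geodesic line $l:(-\infty,\infty)\to X$ with $l(-\infty)=\zeta$ and $l(\infty)=\eta$. *)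

theory Defs
  imports "HOL-Analysis.Analysis"
begin

section \<open>Geodesics and CAT(0) spaces\<close>

definition geodesic_on :: "real set \<Rightarrow> (real \<Rightarrow> 'a::metric_space) \<Rightarrow> bool" where
  "geodesic_on I c \<longleftrightarrow> (\<forall>s\<in>I. \<forall>t\<in>I. dist (c s) (c t) = \<bar>s - t\<bar>)"

text \<open>Rays are total functions on the reals; only their values on \<open>{0..}\<close> matter.\<close>

definition geodesic_ray :: "(real \<Rightarrow> 'a::metric_space) \<Rightarrow> bool" where
  "geodesic_ray b \<longleftrightarrow> geodesic_on {0..} b"

definition geodesic_line :: "(real \<Rightarrow> 'a::metric_space) \<Rightarrow> bool" where
  "geodesic_line l \<longleftrightarrow> geodesic_on UNIV l"

definition geodesic_segment :: "'a::metric_space \<Rightarrow> 'a \<Rightarrow> 'a set \<Rightarrow> bool" where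
  "geodesic_segment x y S \<longleftrightarrow>
     (\<exists>c. geodesic_on {0..dist x y} c \<and> c 0 = x \<and> c (dist x y) = y \<and> S = c ` {0..dist x y})"

text \<open>
  \<open>x'\<close> is a comparison point for the point \<open>x\<close> of the segment \<open>S\<close> issuing from \<open>u\<close>, where
  \<open>u'\<close> and \<open>v'\<close> are the comparison points of the endpoints of \<open>S\<close>.
\<close>

definition comparison_point ::
  "'a::metric_space set \<Rightarrow> 'a \<Rightarrow> real^2 \<Rightarrow> real^2 \<Rightarrow> 'a \<Rightarrow> real^2 \<Rightarrow> bool" where
  "comparison_point S u u' v' x x' \<longleftrightarrow>
     x \<in> S \<and> x' \<in> closed_segment u' v' \<and> dist u' x' = dist u x"

text \<open>
  A geodesic metric space is CAT(0) if every geodesic triangle (vertices \<open>p, q, r\<close> and sides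
  \<open>A, B, C\<close>) is at least as thin as its comparison triangle in the Euclidean plane.
\<close>

definition CAT0_space :: "'a::metric_space itself \<Rightarrow> bool" where
  "CAT0_space T \<longleftrightarrow>
     (\<forall>x y :: 'a. \<exists>S. geodesic_segment x y S) \<and>
     (\<forall>(p :: 'a) q r A B C p' q' r'.
        geodesic_segment p q A \<and> geodesic_segment q r B \<and> geodesic_segment r p C \<and>
        dist p' q' = dist p q \<and> dist q' r' = dist q r \<and> dist r' p' = dist r p \<longrightarrow>
        (\<forall>x y x' y'.
           (comparison_point A p p' q' x x' \<or> comparison_point B q q' r' x x' \<or>
            comparison_point C r r' p' x x') \<and>
           (comparison_point A p p' q' y y' \<or> comparison_point B q q' r' y y' \<or>
            comparison_point C r r' p' y y') \<longrightarrow>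
           dist x y \<le> dist x' y'))"

definition proper_space :: "'a::metric_space itself \<Rightarrow> bool" where
  "proper_space T \<longleftrightarrow> (\<forall>(x :: 'a) r. compact (cball x r))"

section \<open>The visual boundary\<close>

definition asymptotic :: "((real \<Rightarrow> 'a::metric_space) \<times> (real \<Rightarrow> 'a)) set" where
  "asymptotic = {(b, c). geodesic_ray b \<and> geodesic_ray c \<and> (\<exists>K. \<forall>t\<ge>0. dist (b t) (c t) \<le> K)}"

lemma equiv_asymptotic: "equiv {b. geodesic_ray b} asymptotic"
proof (rule equivI)
  show "asymptotic \<subseteq> {b :: real \<Rightarrow> 'a. geodesic_ray b} \<times> {b. geodesic_ray b}"
    by (auto simp: asymptotic_def)
  show "refl_on {b. geodesic_ray b} asymptotic"
    by (auto simp: refl_on_def asymptotic_def)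
  show "sym asymptotic"
    by (auto simp: sym_def asymptotic_def dist_commute)
  show "trans (asymptotic :: ((real \<Rightarrow> 'a) \<times> (real \<Rightarrow> 'a)) set)"
  proof (rule transI)
    fix a b c :: "real \<Rightarrow> 'a"
    assume ab: "(a, b) \<in> asymptotic" and bc: "(b, c) \<in> asymptotic"
    obtain K where K: "\<forall>t\<ge>0. dist (a t) (b t) \<le> K"
      using ab by (auto simp: asymptotic_def)
    obtain L where L: "\<forall>t\<ge>0. dist (b t) (c t) \<le> L"
      using bc by (auto simp: asymptotic_def)
    have "\<forall>t\<ge>0. dist (a t) (c t) \<le> K + L"
      using K L by (meson add_mono dist_triangle order_trans)
    with ab bc show "(a, c) \<in> asymptotic"
      by (auto simp: asymptotic_def)
  qed
qed

definition visual_boundary :: "(real \<Rightarrow> 'a::metric_space) set set" where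
  "visual_boundary = {b. geodesic_ray b} // asymptotic"

definition endpoint :: "(real \<Rightarrow> 'a::metric_space) \<Rightarrow> (real \<Rightarrow> 'a) set" where
  "endpoint b = asymptotic `` {b}"

definition line_joins ::
  "(real \<Rightarrow> 'a::metric_space) \<Rightarrow> (real \<Rightarrow> 'a) set \<Rightarrow> (real \<Rightarrow> 'a) set \<Rightarrow> bool" where
  "line_joins l \<zeta> \<eta> \<longleftrightarrow>
     geodesic_line l \<and> endpoint (\<lambda>t. l (- t)) = \<zeta> \<and> endpoint l = \<eta>"

definition visibility_point :: "(real \<Rightarrow> 'a::metric_space) set \<Rightarrow> bool" where
  "visibility_point \<zeta> \<longleftrightarrow>
     \<zeta> \<in> visual_boundary \<and>
     (\<forall>\<eta>\<in>visual_boundary. \<eta> \<noteq> \<zeta> \<longrightarrow> (\<exists>l. line_joins l \<zeta> \<eta>))"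

section \<open>Sublinearly contracting rays\<close>

text \<open>\<open>mono_on\<close> is non-strict, so that constant functions count as sublinear.\<close>

definition sublinear_function :: "(real \<Rightarrow> real) \<Rightarrow> bool" where
  "sublinear_function \<kappa> \<longleftrightarrow>
     (\<forall>t\<ge>0. 1 \<le> \<kappa> t) \<and> mono_on {0..} \<kappa> \<and> concave_on {0..} \<kappa> \<and>
     ((\<lambda>t. \<kappa> t / t) \<longlongrightarrow> 0) at_top"

text \<open>
  The library's \<open>closest_point\<close>, without its restriction to inner product spaces. The image of a
  ray in a CAT(0) space is convex and complete, so there the nearest point exists and is unique.
\<close>

definition nearest_point :: "'a::metric_space set \<Rightarrow> 'a \<Rightarrow> 'a" where
  "nearest_point S x = (SOME p. p \<in> S \<and> (\<forall>q\<in>S. dist x p \<le> dist x q))"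

text \<open>
  In a CAT(0) space the projection to a ray is 1-Lipschitz, so that \<open>diameter\<close> is applied to a
  bounded set, and it makes no difference whether balls are open or closed.
\<close>

definition contracting_ray :: "(real \<Rightarrow> real) \<Rightarrow> (real \<Rightarrow> 'a::metric_space) \<Rightarrow> bool" where
  "contracting_ray \<kappa> b \<longleftrightarrow>
     (\<exists>n\<ge>0. \<forall>x r. ball x r \<inter> b ` {0..} = {} \<longrightarrow>
        diameter (nearest_point (b ` {0..}) ` ball x r) \<le> n * \<kappa> (dist x (b 0)))"

definition sublinearly_contracting_ray :: "(real \<Rightarrow> 'a::metric_space) \<Rightarrow> bool" where
  "sublinearly_contracting_ray b \<longleftrightarrow>
     geodesic_ray b \<and> (\<exists>\<kappa>. sublinear_function \<kappa> \<and> contracting_ray \<kappa> b)"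

end

theory Submission
  imports Defs
begin

text \<open>
  Let \<open>P x\<close> be the parameter of the projection of \<open>x\<close> to the contracting ray \<open>c\<close> and \<open>D x\<close> the
  distance from \<open>x\<close> to \<open>c\<close>. Suppose that a geodesic ends at \<open>y\<close> with \<open>P y = s\<close>, that \<open>w\<close> is a point on
  it with \<open>D w = \<bar>P w - s\<bar> = R\<close>, and that \<open>D\<close> is at least \<open>R\<close> from \<open>w\<close> on. Thinness of the triangle
  \<open>w\<close>, \<open>c s\<close>, \<open>y\<close> gives a point \<open>u\<close> of the geodesic within \<open>7 R\<close> of \<open>w\<close> that lies in a ball disjoint from
  \<open>c\<close> whose centre projects to \<open>c s\<close>; the piece from \<open>w\<close> to \<open>u\<close> is covered by eight balls of radius \<open>R\<close>
  disjoint from \<open>c\<close>. Contraction moves the projection by a sublinear amount in each of these balls,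
  so \<open>R = o(s)\<close>.

  Applied to a ray \<open>b\<close> not asymptotic to \<open>c\<close>, along which \<open>D\<close> grows linearly by convexity, this bounds
  \<open>P\<close> on \<open>b\<close>. Applied to the geodesics from \<open>c N\<close> to \<open>b N\<close>, it shows that they all meet a fixed ball
  around \<open>c 0\<close>; a limit of these geodesics is the required line.
\<close>

section \<open>Comparison geometry\<close>

text \<open>Speed is proportional to arc length and the domain is always the unit interval.
  Geodesics of different lengths can then be compared at one common parameter, and constant
  geodesics need no special case.\<close>

definition affine_geodesic :: "(real \<Rightarrow> 'a::metric_space) \<Rightarrow> bool" where
  "affine_geodesic \<alpha> \<longleftrightarrow>
     (\<forall>s\<in>{0..1}. \<forall>t\<in>{0..1}. dist (\<alpha> s) (\<alpha> t) = \<bar>s - t\<bar> * dist (\<alpha> 0) (\<alpha> 1))"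

lemma affine_geodesicD:
  "affine_geodesic \<alpha> \<Longrightarrow> 0 \<le> s \<Longrightarrow> s \<le> 1 \<Longrightarrow> 0 \<le> t \<Longrightarrow> t \<le> 1 \<Longrightarrow>
     dist (\<alpha> s) (\<alpha> t) = \<bar>s - t\<bar> * dist (\<alpha> 0) (\<alpha> 1)"
  unfolding affine_geodesic_def by (meson atLeastAtMost_iff)

lemma affine_geodesic_reverse:
  assumes "affine_geodesic \<alpha>"
  shows "affine_geodesic (\<lambda>t. \<alpha> (1 - t))"
  unfolding affine_geodesic_def
proof (intro ballI)
  fix s t :: real assume "s \<in> {0..1}" "t \<in> {0..1}"
  then have "dist (\<alpha> (1 - s)) (\<alpha> (1 - t)) = \<bar>(1 - s) - (1 - t)\<bar> * dist (\<alpha> 0) (\<alpha> 1)"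
    by (intro affine_geodesicD[OF assms]) auto
  then show "dist (\<alpha> (1 - s)) (\<alpha> (1 - t)) = \<bar>s - t\<bar> * dist (\<alpha> (1 - 0)) (\<alpha> (1 - 1))"
    by (simp add: dist_commute abs_minus_commute)
qed

lemma affine_geodesic_of_geodesic_on:
  assumes "geodesic_on {a..b} g" "a \<le> b"
  shows "affine_geodesic (\<lambda>t. g (a + t * (b - a)))"
  unfolding affine_geodesic_def
proof (intro ballI)
  fix s t :: real assume st: "s \<in> {0..1}" "t \<in> {0..1}"
  have in_ab: "a + r * (b - a) \<in> {a..b}" if "r \<in> {0..1}" for r
  proof -
    have "0 \<le> r * (b - a)" "r * (b - a) \<le> b - a"
      using that assms(2) mult_left_le_one_le[of "b - a" r] by simp_all
    then show ?thesis by simp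
  qed
  have d: "dist (g (a + r * (b - a))) (g (a + r' * (b - a))) = \<bar>r - r'\<bar> * (b - a)"
    if r: "r \<in> {0..1}" "r' \<in> {0..1}" for r r'
  proof -
    have "dist (g (a + r * (b - a))) (g (a + r' * (b - a)))
        = \<bar>(a + r * (b - a)) - (a + r' * (b - a))\<bar>"
      using assms(1) in_ab[OF r(1)] in_ab[OF r(2)] unfolding geodesic_on_def by blast
    also have "(a + r * (b - a)) - (a + r' * (b - a)) = (r - r') * (b - a)"
      by (simp add: left_diff_distrib)
    finally show ?thesis
      using assms(2) by (simp add: abs_mult)
  qed
  show "dist (g (a + s * (b - a))) (g (a + t * (b - a)))
      = \<bar>s - t\<bar> * dist (g (a + 0 * (b - a))) (g (a + 1 * (b - a)))"
    unfolding d[OF st] using d[of 0 1] by simp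
qed

text \<open>Bridges to the unit-speed segments in which \<open>CAT0_space\<close> is stated.
  Rescaling divides by \<open>dist x y\<close>, hence the separate case of a constant
  geodesic.\<close>

lemma geodesic_segment_affine:
  assumes "affine_geodesic \<alpha>" and "\<alpha> 0 = x" and "\<alpha> 1 = y"
  shows "geodesic_segment x y (\<alpha> ` {0..1})"
proof (cases "x = y")
  case True
  have "\<alpha> t = x" if "t \<in> {0..1}" for t
    using affine_geodesicD[OF assms(1), of t 0] that assms True by simp
  then have "\<alpha> ` {0..1} = {x}" by force
  with True show ?thesis
    unfolding geodesic_segment_def geodesic_on_def by (auto intro!: exI[of _ "\<lambda>_. x"])
next
  case False
  define d where "d = dist x y"
  have d: "d > 0" using False by (simp add: d_def)
  have "geodesic_on {0..d} (\<lambda>t. \<alpha> (t / d))"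
    unfolding geodesic_on_def
  proof (intro ballI)
    fix s t assume "s \<in> {0..d}" "t \<in> {0..d}"
    then have "0 \<le> s / d" "s / d \<le> 1" "0 \<le> t / d" "t / d \<le> 1"
      using d by auto
    from affine_geodesicD[OF assms(1) this]
    have "dist (\<alpha> (s / d)) (\<alpha> (t / d)) = \<bar>(s - t) / d\<bar> * d"
      unfolding assms(2,3) d_def[symmetric] diff_divide_distrib .
    also have "\<dots> = \<bar>s - t\<bar>"
      using d by (simp add: abs_divide)
    finally show "dist (\<alpha> (s / d)) (\<alpha> (t / d)) = \<bar>s - t\<bar>" .
  qed
  moreover have "\<alpha> ` {0..1} = (\<lambda>t. \<alpha> (t / d)) ` {0..d}"
  proof -
    have "(\<lambda>t. t / d) ` {0..d} = {0..1}"
    proof (intro equalityI subsetI)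
      fix t :: real assume t: "t \<in> {0..1}"
      then show "t \<in> (\<lambda>t. t / d) ` {0..d}"
        using d mult_left_le_one_le[of d t] by (intro image_eqI[of _ _ "t * d"]) auto
    qed (use d in auto)
    then show ?thesis by (metis image_image)
  qed
  ultimately show ?thesis
    unfolding geodesic_segment_def using d assms
    by (intro exI[of _ "\<lambda>t. \<alpha> (t / d)"]) (auto simp: d_def)
qed

section \<open>Comparison triangles and convexity of the distance\<close>

lemma comparison_triangle:
  fixes a b c :: real
  assumes "a \<ge> 0" "b \<ge> 0" "c \<ge> 0" "a \<le> b + c" "b \<le> a + c" "c \<le> a + b"
  obtains p q r :: "real^2" where "dist p q = a" "dist q r = b" "dist r p = c"
proof (cases "a = 0")
  case True
  then have "b = c" using assms by simp
  have "dist (vector [c, 0] :: real^2) 0 = c"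
    unfolding dist_norm norm_vec_def L2_set_def sum_2 using assms by simp
  then show thesis
    using that[of 0 0 "vector [c, 0]"] True \<open>b = c\<close> by (simp add: dist_commute)
next
  case False
  then have a: "a > 0" using assms by simp
  \<comment> \<open>With \<open>p\<close> at the origin and \<open>q\<close> on the first axis, the
    law of cosines forces \<open>u\<close> as the first coordinate of \<open>r\<close>.\<close>
  define u where "u = (a\<^sup>2 + c\<^sup>2 - b\<^sup>2) / (2 * a)"
  have ua: "2 * a * u = a\<^sup>2 + c\<^sup>2 - b\<^sup>2" using a by (simp add: u_def)
  \<comment> \<open>The triangle inequalities say
    \<open>\<bar>a - c\<bar> \<le> b \<le> a + c\<close>, which amounts to
    \<open>\<bar>u\<bar> \<le> c\<close>; this makes the second coordinate \<open>v\<close>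
    real.\<close>
  have "(a - c)\<^sup>2 \<le> b\<^sup>2"
    using assms by (intro abs_le_square_iff[THEN iffD1]) auto
  moreover have "b\<^sup>2 \<le> (a + c)\<^sup>2"
    using assms by (intro power_mono) auto
  ultimately have "2 * a * u \<le> 2 * a * c" "2 * a * (- c) \<le> 2 * a * u"
    unfolding ua by (auto simp: power2_eq_square algebra_simps)
  then have "\<bar>u\<bar> \<le> c"
    using mult_le_cancel_left_pos[of "2 * a" u c] mult_le_cancel_left_pos[of "2 * a" "- c" u] a
    by linarith
  then have "u\<^sup>2 \<le> c\<^sup>2" using abs_le_square_iff[of u c] assms by simp
  define v where "v = sqrt (c\<^sup>2 - u\<^sup>2)"
  have v: "v\<^sup>2 = c\<^sup>2 - u\<^sup>2" using \<open>u\<^sup>2 \<le> c\<^sup>2\<close> by (simp add: v_def)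
  let ?q = "vector [a, 0] :: real^2" and ?r = "vector [u, v] :: real^2"
  have "dist 0 ?q = a"
    unfolding dist_norm norm_vec_def L2_set_def sum_2 using a by simp
  moreover have "dist ?r 0 = c"
    unfolding dist_norm norm_vec_def L2_set_def sum_2 using assms by (simp add: v)
  moreover have "dist ?q ?r = b"
  proof -
    have "(a - u)\<^sup>2 + v\<^sup>2 = b\<^sup>2"
      using ua by (simp add: v power2_diff)
    then show ?thesis
      unfolding dist_norm norm_vec_def L2_set_def sum_2 using assms by simp
  qed
  ultimately show thesis using that by blast
qed

context
  assumes cat0: "CAT0_space TYPE('a::metric_space)"
begin

lemma affine_geodesic_exists:
  obtains \<alpha> where "affine_geodesic \<alpha>" "\<alpha> 0 = (x::'a)" "\<alpha> 1 = y"
proof -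
  obtain S where "geodesic_segment x y S"
    using cat0 unfolding CAT0_space_def by blast
  then obtain g where g: "geodesic_on {0..dist x y} g" "g 0 = x" "g (dist x y) = y"
    unfolding geodesic_segment_def by blast
  then show thesis
    using that[of "\<lambda>t. g (0 + t * (dist x y - 0))"] affine_geodesic_of_geodesic_on[OF g(1)]
    by simp
qed

lemma CAT0_comparison:
  fixes p q r :: 'a
  assumes "geodesic_segment p q A" "geodesic_segment q r B" "geodesic_segment r p C"
    and "dist p' q' = dist p q" "dist q' r' = dist q r" "dist r' p' = dist r p"
    and "comparison_point A p p' q' x x' \<or> comparison_point B q q' r' x x' \<or>
            comparison_point C r r' p' x x'"
    and "comparison_point A p p' q' y y' \<or> comparison_point B q q' r' y y' \<or>
            comparison_point C r r' p' y y'"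
  shows "dist x y \<le> dist x' y'"
  using conjunct2[OF cat0[unfolded CAT0_space_def], rule_format, of p q A r B C p' q' r' x x' y y'] assms
  by blast

lemma comparison_triangle_of:
  fixes p q r :: 'a
  obtains p' q' r' :: "real^2"
  where "dist p' q' = dist p q" "dist q' r' = dist q r" "dist r' p' = dist r p"
proof (rule comparison_triangle[of "dist p q" "dist q r" "dist r p"])
  show "dist p q \<le> dist q r + dist r p" "dist q r \<le> dist p q + dist r p"
    "dist r p \<le> dist p q + dist q r"
    by (metis dist_commute dist_triangle add.commute)+
qed (use that in auto)

text \<open>The comparison points at parameter \<open>t\<close> are the images of \<open>q'\<close>
  and \<open>r'\<close> under the homothety of ratio \<open>t\<close> centred at
  \<open>p'\<close>.\<close>

lemma affine_geodesics_common_start: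
  fixes \<alpha> \<beta> :: "real \<Rightarrow> 'a"
  assumes \<alpha>: "affine_geodesic \<alpha>" and \<beta>: "affine_geodesic \<beta>" and start: "\<alpha> 0 = \<beta> 0"
    and t: "0 \<le> t" "t \<le> 1"
  shows "dist (\<alpha> t) (\<beta> t) \<le> t * dist (\<alpha> 1) (\<beta> 1)"
proof -
  let ?p = "\<alpha> 0" and ?q = "\<alpha> 1" and ?r = "\<beta> 1"
  obtain p' q' r' :: "real^2" where tri:
    "dist p' q' = dist ?p ?q" "dist q' r' = dist ?q ?r" "dist r' p' = dist ?r ?p"
    by (rule comparison_triangle_of)
  have A: "geodesic_segment ?p ?q (\<alpha> ` {0..1})"
    by (rule geodesic_segment_affine[OF \<alpha>]) auto
  obtain B where B: "geodesic_segment ?q ?r B"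
    using cat0 unfolding CAT0_space_def by blast
  \<comment> \<open>The third side of a triangle runs from \<open>?r\<close> back to
    \<open>?p\<close>, so \<open>\<beta>\<close> enters reversed.\<close>
  have C: "geodesic_segment ?r ?p ((\<lambda>t. \<beta> (1 - t)) ` {0..1})"
    by (rule geodesic_segment_affine[OF affine_geodesic_reverse[OF \<beta>]]) (use start in auto)
  define x' where "x' = (1 - t) *\<^sub>R p' + t *\<^sub>R q'"
  define y' where "y' = (1 - t) *\<^sub>R p' + t *\<^sub>R r'"
  have x': "comparison_point (\<alpha> ` {0..1}) ?p p' q' (\<alpha> t) x'"
  proof -
    have "p' - x' = t *\<^sub>R (p' - q')" by (simp add: x'_def algebra_simps)
    then have "dist p' x' = t * dist p' q'" using t by (simp add: dist_norm)
    moreover have "dist ?p (\<alpha> t) = t * dist ?p ?q"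
      using affine_geodesicD[OF \<alpha>, of 0 t] t by simp
    ultimately show ?thesis
      using t tri unfolding comparison_point_def closed_segment_def x'_def by auto
  qed
  have y': "comparison_point ((\<lambda>t. \<beta> (1 - t)) ` {0..1}) ?r r' p' (\<beta> t) y'"
  proof -
    have "r' - y' = (1 - t) *\<^sub>R (r' - p')" by (simp add: y'_def algebra_simps)
    then have "dist r' y' = (1 - t) * dist r' p'" using t by (simp add: dist_norm)
    moreover have "dist ?r (\<beta> t) = (1 - t) * dist ?r ?p"
      using affine_geodesicD[OF \<beta>, of 1 t] t start by (simp add: dist_commute)
    moreover have "\<beta> t \<in> (\<lambda>t. \<beta> (1 - t)) ` {0..1}"
      using t by (intro image_eqI[of _ _ "1 - t"]) auto
    moreover have "y' \<in> closed_segment r' p'"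
      unfolding closed_segment_commute[of r'] using t by (auto simp: closed_segment_def y'_def)
    ultimately show ?thesis
      using tri unfolding comparison_point_def by auto
  qed
  have "dist (\<alpha> t) (\<beta> t) \<le> dist x' y'"
    using CAT0_comparison[OF A B C tri] x' y' by blast
  also have "x' - y' = t *\<^sub>R (q' - r')"
    by (simp add: x'_def y'_def algebra_simps)
  then have "dist x' y' = t * dist q' r'"
    using t by (simp add: dist_norm)
  finally show ?thesis using tri by simp
qed

lemma affine_geodesics_common_end:
  fixes \<alpha> \<beta> :: "real \<Rightarrow> 'a"
  assumes "affine_geodesic \<alpha>" "affine_geodesic \<beta>" "\<alpha> 1 = \<beta> 1" "0 \<le> t" "t \<le> 1"
  shows "dist (\<alpha> t) (\<beta> t) \<le> (1 - t) * dist (\<alpha> 0) (\<beta> 0)"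
  using affine_geodesics_common_start[OF assms(1,2)[THEN affine_geodesic_reverse], of "1 - t"] assms
  by simp

text \<open>The diagonal \<open>\<delta>\<close> cuts the quadrilateral into two triangles, one with
  a common start and one with a common end.\<close>

lemma affine_geodesics_convex:
  fixes \<alpha> \<beta> :: "real \<Rightarrow> 'a"
  assumes "affine_geodesic \<alpha>" "affine_geodesic \<beta>" "0 \<le> t" "t \<le> 1"
  shows "dist (\<alpha> t) (\<beta> t) \<le> (1 - t) * dist (\<alpha> 0) (\<beta> 0) + t * dist (\<alpha> 1) (\<beta> 1)"
proof -
  obtain \<delta> where \<delta>: "affine_geodesic \<delta>" "\<delta> 0 = \<alpha> 0" "\<delta> 1 = \<beta> 1"
    by (rule affine_geodesic_exists)
  have "dist (\<alpha> t) (\<beta> t) \<le> dist (\<alpha> t) (\<delta> t) + dist (\<delta> t) (\<beta> t)"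
    by (rule dist_triangle)
  with affine_geodesics_common_start[OF assms(1) \<delta>(1) _ assms(3,4)]
    affine_geodesics_common_end[OF \<delta>(1) assms(2) _ assms(3,4)] \<delta>
  show ?thesis by simp
qed

text \<open>The CN inequality of Bruhat and Tits: the median is no longer than the Euclidean median,
  whose length the parallelogram law gives.\<close>

lemma CAT0_midpoint:
  fixes \<alpha> :: "real \<Rightarrow> 'a"
  assumes \<alpha>: "affine_geodesic \<alpha>"
  shows "(dist p (\<alpha> (1/2)))\<^sup>2 \<le>
    ((dist p (\<alpha> 0))\<^sup>2 + (dist p (\<alpha> 1))\<^sup>2) / 2 - (dist (\<alpha> 0) (\<alpha> 1))\<^sup>2 / 4"
proof -
  let ?q = "\<alpha> 0" and ?r = "\<alpha> 1"
  obtain p' q' r' :: "real^2" where tri: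
    "dist p' q' = dist p ?q" "dist q' r' = dist ?q ?r" "dist r' p' = dist ?r p"
    by (rule comparison_triangle_of)
  obtain A where A: "geodesic_segment p ?q A"
    using cat0 unfolding CAT0_space_def by blast
  have B: "geodesic_segment ?q ?r (\<alpha> ` {0..1})"
    by (rule geodesic_segment_affine[OF \<alpha>]) auto
  obtain C where C: "geodesic_segment ?r p C"
    using cat0 unfolding CAT0_space_def by blast
  have "p \<in> A" using A unfolding geodesic_segment_def by force
  then have p: "comparison_point A p p' q' p p'"
    by (simp add: comparison_point_def)
  have m: "comparison_point (\<alpha> ` {0..1}) ?q q' r' (\<alpha> (1/2)) (midpoint q' r')"
    using affine_geodesicD[OF \<alpha>, of 0 "1/2"] tri
    by (auto simp: comparison_point_def dist_midpoint)
  have "dist p (\<alpha> (1/2)) \<le> dist p' (midpoint q' r')"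
    using CAT0_comparison[OF A B C tri] p m by blast
  then have "(dist p (\<alpha> (1/2)))\<^sup>2 \<le> (dist p' (midpoint q' r'))\<^sup>2"
    by (intro power_mono) auto
  also have "(dist p' (midpoint q' r'))\<^sup>2
      = ((dist p' q')\<^sup>2 + (dist r' p')\<^sup>2) / 2 - (dist q' r')\<^sup>2 / 4"
    unfolding dist_norm power2_norm_eq_inner midpoint_def
    by (simp add: algebra_simps inner_commute) (simp add: field_simps)
  finally show ?thesis using tri by (simp add: dist_commute)
qed

end

section \<open>Convex and sublinear functions of a real variable\<close>

lemma convex_on_three_points:
  fixes f :: "real \<Rightarrow> real"
  assumes "convex_on {a..b} f" "a \<le> u" "u \<le> v" "v \<le> b"
  shows "(v - a) * f u \<le> (v - u) * f a + (u - a) * f v"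
proof (cases "a = v")
  case True
  with assms show ?thesis by simp
next
  case False
  then have va: "v - a > 0" using assms by simp
  define t where "t = (u - a) / (v - a)"
  have t: "0 \<le> t" "t \<le> 1" using va assms by (auto simp: t_def)
  have tv: "t * (v - a) = u - a" using va by (simp add: t_def)
  have u: "(1 - t) * a + t * v = u" using tv by (simp add: algebra_simps)
  have "f ((1 - t) *\<^sub>R a + t *\<^sub>R v) \<le> (1 - t) * f a + t * f v"
    using t assms by (intro convex_onD[OF assms(1)]) auto
  then have "f u \<le> (1 - t) * f a + t * f v" using u by simp
  then have "(v - a) * f u \<le> (v - a) * ((1 - t) * f a + t * f v)"
    using va by (intro mult_left_mono) auto
  also have "\<dots> = ((v - a) - t * (v - a)) * f a + (t * (v - a)) * f v"
    by (simp add: algebra_simps)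
  finally show ?thesis unfolding tv by simp
qed

text \<open>The chord from \<open>a\<close> to \<open>u\<close> has nonnegative slope, and slopes of
  a convex function do not decrease.\<close>

lemma convex_on_mono_after_start:
  fixes f :: "real \<Rightarrow> real"
  assumes "convex_on {a..b} f" "a < u" "u \<le> v" "v \<le> b" "f a \<le> f u"
  shows "f u \<le> f v"
proof -
  have "(v - a) * f u \<le> (v - u) * f a + (u - a) * f v"
    using convex_on_three_points[OF assms(1), of u v] assms by simp
  also have "(v - u) * f a \<le> (v - u) * f u"
    using assms by (intro mult_left_mono) auto
  finally have "(u - a) * f u \<le> (u - a) * f v"
    by (simp add: algebra_simps)
  then show ?thesis using assms by simp
qed

text \<open>Beyond some \<open>M\<close> the ratio \<open>\<kappa> t / t\<close> is small; up to
  \<open>M\<close>, monotonicity bounds \<open>\<kappa>\<close> by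
  \<open>\<kappa> M\<close>.\<close>

lemma sublinear_affine_bound:
  assumes "sublinear_function \<kappa>" "n \<ge> 0" "\<theta> > 0"
  obtains C where "C \<ge> 0" "\<And>t. t \<ge> 0 \<Longrightarrow> n * \<kappa> t \<le> \<theta> * t + C"
proof -
  have lim: "((\<lambda>t. \<kappa> t / t) \<longlongrightarrow> 0) at_top" and mono: "mono_on {0..} \<kappa>"
    and one: "\<And>t. t \<ge> 0 \<Longrightarrow> 1 \<le> \<kappa> t"
    using assms(1) by (auto simp: sublinear_function_def)
  \<comment> \<open>Dividing by \<open>n + 1\<close> instead of \<open>n\<close> covers
    \<open>n = 0\<close>.\<close>
  have "eventually (\<lambda>t. \<kappa> t / t < \<theta> / (n + 1)) at_top"
    using order_tendstoD(2)[OF lim] assms by simp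
  then obtain N where N: "\<And>t. t \<ge> N \<Longrightarrow> \<kappa> t / t < \<theta> / (n + 1)"
    unfolding eventually_at_top_linorder by blast
  define M where "M = max N 1"
  show thesis
  proof (rule that[of "n * \<kappa> M"])
    have "1 \<le> \<kappa> M" by (rule one) (simp add: M_def)
    then show "n * \<kappa> M \<ge> 0" using assms(2) by simp
    fix t :: real assume t: "t \<ge> 0"
    show "n * \<kappa> t \<le> \<theta> * t + n * \<kappa> M"
    proof (cases "t \<le> M")
      case True
      then have "\<kappa> t \<le> \<kappa> M" using t mono by (auto simp: mono_on_def)
      then have "n * \<kappa> t \<le> n * \<kappa> M" using assms by (intro mult_left_mono) auto
      moreover have "0 \<le> \<theta> * t" using t assms by simp
      ultimately show ?thesis by linarith
    next
      case False
      then have tM: "t \<ge> N" "t > 0" by (auto simp: M_def)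
      then have "\<kappa> t \<le> \<theta> / (n + 1) * t" using N[of t] by (simp add: pos_divide_less_eq)
      then have "(n + 1) * \<kappa> t \<le> (n + 1) * (\<theta> / (n + 1) * t)"
        using assms by (intro mult_left_mono) auto
      also have "\<dots> = \<theta> * t" using assms by (simp add: field_simps)
      finally have "n * \<kappa> t + \<kappa> t \<le> \<theta> * t" by (simp add: algebra_simps)
      then show ?thesis using one[of t] \<open>n * \<kappa> M \<ge> 0\<close> t by linarith
    qed
  qed
qed

section \<open>Projection to a ray\<close>

lemma geodesic_on_subset: "geodesic_on I g \<Longrightarrow> J \<subseteq> I \<Longrightarrow> geodesic_on J g"
  unfolding geodesic_on_def by blast

lemma geodesic_on_continuous: "geodesic_on I g \<Longrightarrow> continuous_on I g"
  unfolding geodesic_on_def continuous_on_iff by (metis dist_real_def)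

locale CAT0_ray =
  fixes c :: "real \<Rightarrow> 'a::metric_space"
  assumes cat0: "CAT0_space TYPE('a)"
    and ray: "geodesic_ray c"
begin

lemma ray_dist: "0 \<le> s \<Longrightarrow> 0 \<le> t \<Longrightarrow> dist (c s) (c t) = \<bar>s - t\<bar>"
  using ray by (simp add: geodesic_ray_def geodesic_on_def)

text \<open>A real parameter instead of a point turns distances between projections into absolute
  differences. It is determined because the nearest point is attained and \<open>c\<close> is
  injective on \<open>{0..}\<close>.\<close>

definition P :: "'a \<Rightarrow> real" where
  "P x = (SOME t. 0 \<le> t \<and> c t = nearest_point (c ` {0..}) x)"

definition D :: "'a \<Rightarrow> real" where
  "D x = dist x (c (P x))"

lemma nearest_point_exists:
  obtains t where "0 \<le> t" "\<And>r. 0 \<le> r \<Longrightarrow> dist x (c t) \<le> dist x (c r)"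
proof -
  \<comment> \<open>Beyond this parameter the triangle inequality puts \<open>c r\<close> farther
    from \<open>x\<close> than \<open>c 0\<close>, so a compact interval suffices.\<close>
  define M where "M = 2 * dist x (c 0)"
  have "continuous_on {0..M} c"
    using ray geodesic_on_continuous geodesic_on_subset[of "{0..}" c "{0..M}"]
    by (auto simp: geodesic_ray_def)
  then have "continuous_on {0..M} (\<lambda>t. dist x (c t))"
    by (intro continuous_intros)
  moreover have "{0..M} \<noteq> {}" by (auto simp: M_def)
  ultimately obtain t where t: "t \<in> {0..M}" "\<And>r. r \<in> {0..M} \<Longrightarrow> dist x (c t) \<le> dist x (c r)"
    using continuous_attains_inf[of "{0..M}" "\<lambda>t. dist x (c t)"] by auto
  show thesis
  proof (rule that)
    fix r :: real assume r: "0 \<le> r"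
    show "dist x (c t) \<le> dist x (c r)"
    proof (cases "r \<le> M")
      case False
      have "r \<le> dist x (c 0) + dist x (c r)"
        using dist_triangle[of "c 0" "c r" x] ray_dist[of 0 r] r by (simp add: dist_commute)
      moreover have "dist x (c t) \<le> dist x (c 0)"
        using t by (simp add: M_def)
      ultimately show ?thesis using False by (simp add: M_def)
    qed (use t r in auto)
  qed (use t in auto)
qed

lemma nearest_point_P: "0 \<le> P x" "c (P x) = nearest_point (c ` {0..}) x"
  and D_le: "0 \<le> t \<Longrightarrow> D x \<le> dist x (c t)"
proof -
  let ?p = "nearest_point (c ` {0..}) x"
  obtain t0 where t0: "0 \<le> t0" "\<And>r. 0 \<le> r \<Longrightarrow> dist x (c t0) \<le> dist x (c r)"
    using nearest_point_exists by blast
  have p: "?p \<in> c ` {0..} \<and> (\<forall>q\<in>c ` {0..}. dist x ?p \<le> dist x q)"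
    unfolding nearest_point_def by (rule someI[of _ "c t0"]) (use t0 in auto)
  then have "\<exists>t. 0 \<le> t \<and> c t = ?p" by auto
  from someI_ex[OF this] show P: "0 \<le> P x" "c (P x) = ?p"
    unfolding P_def by auto
  show "0 \<le> t \<Longrightarrow> D x \<le> dist x (c t)"
    unfolding D_def P(2) using p by auto
qed

lemma D_nonneg: "0 \<le> D x"
  by (simp add: D_def)

text \<open>Both orders of \<open>s\<close> and \<open>t\<close> are allowed, since the projections
  of two points may come in either order along the ray.\<close>

lemma affine_geodesic_ray:
  assumes "0 \<le> s" "0 \<le> t"
  shows "affine_geodesic (\<lambda>r. c (s + r * (t - s)))"
  unfolding affine_geodesic_def
proof (intro ballI)
  have pos: "0 \<le> s + r * (t - s)" if "r \<in> {0..1}" for r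
  proof -
    have "0 \<le> (1 - r) * s + r * t" using that assms by simp
    then show ?thesis by (simp add: algebra_simps)
  qed
  have d: "dist (c (s + u * (t - s))) (c (s + v * (t - s))) = \<bar>u - v\<bar> * \<bar>t - s\<bar>"
    if "u \<in> {0..1}" "v \<in> {0..1}" for u v
    unfolding ray_dist[OF that[THEN pos]] abs_mult[symmetric] by (simp add: left_diff_distrib)
  fix u v :: real assume uv: "u \<in> {0..1}" "v \<in> {0..1}"
  show "dist (c (s + u * (t - s))) (c (s + v * (t - s))) =
      \<bar>u - v\<bar> * dist (c (s + 0 * (t - s))) (c (s + 1 * (t - s)))"
    unfolding d[OF uv] using d[of 0 1] by simp
qed

text \<open>A quantitative form of uniqueness of the projection: the midpoint of
  \<open>c (P x)\<close> and \<open>c t\<close> lies on the ray, hence at distance at least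
  \<open>D x\<close> from \<open>x\<close>, and the CN inequality then bounds how far apart they
  are.\<close>

lemma P_diff_square_le:
  assumes "0 \<le> t"
  shows "(P x - t)\<^sup>2 \<le> 2 * ((dist x (c t))\<^sup>2 - (D x)\<^sup>2)"
proof -
  note P = nearest_point_P(1)[of x]
  let ?m = "P x + 1/2 * (t - P x)"
  have "0 \<le> ?m" using P assms by (simp add: field_simps)
  then have "(D x)\<^sup>2 \<le> (dist x (c ?m))\<^sup>2"
    by (intro power_mono D_le D_nonneg)
  also have "\<dots> \<le> ((D x)\<^sup>2 + (dist x (c t))\<^sup>2) / 2 - (dist (c (P x)) (c t))\<^sup>2 / 4"
    using CAT0_midpoint[OF cat0 affine_geodesic_ray[OF P assms], of x] by (simp add: D_def)
  also have "(dist (c (P x)) (c t))\<^sup>2 = (P x - t)\<^sup>2"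
    using ray_dist P assms by simp
  finally show ?thesis by (simp add: field_simps)
qed

lemma P_eqI:
  assumes "0 \<le> t" "dist x (c t) \<le> D x"
  shows "P x = t"
proof -
  have "(dist x (c t))\<^sup>2 \<le> (D x)\<^sup>2" using assms by (intro power_mono) auto
  then have "(P x - t)\<^sup>2 \<le> 0" by (intro order_trans[OF P_diff_square_le[OF assms(1)]]) simp
  then show ?thesis by simp
qed

lemma P_ray: "0 \<le> t \<Longrightarrow> P (c t) = t"
  by (intro P_eqI) (auto simp: D_nonneg)

lemma D_le_dist: "D x \<le> dist x y + D y"
  using D_le[OF nearest_point_P(1)[of y], of x] dist_triangle[of x "c (P y)" y]
  by (simp add: D_def)

lemma continuous_on_D: "continuous_on S D"
proof (rule continuous_on_subset[OF _ subset_UNIV])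
  have "dist (D x) (D y) \<le> dist x y" for x y
    using D_le_dist[of x y] D_le_dist[of y x] by (simp add: dist_real_def dist_commute)
  then show "continuous_on UNIV D"
    unfolding continuous_on_iff by (meson order_le_less_trans)
qed

text \<open>For \<open>y\<close> near \<open>x\<close>, the point \<open>c (P y)\<close> almost
  minimises the distance from \<open>x\<close>, so \<open>P_diff_square_le\<close> puts it near
  \<open>c (P x)\<close>.\<close>

lemma continuous_on_P: "continuous_on S P"
proof (rule continuous_on_subset[OF _ subset_UNIV])
  show "continuous_on UNIV P"
    unfolding continuous_on_iff
  proof (intro ballI allI impI)
    fix x :: 'a and e :: real assume e: "e > 0"
    \<comment> \<open>The bound 1 turns \<open>D x + dist x y\<close> into at most
      \<open>D x + 1\<close>; the other entry makes \<open>8 * d * (D x + 1)\<close> at most the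
      square of \<open>e\<close>.\<close>
    define d where "d = min 1 (e\<^sup>2 / (8 * (D x + 1)))"
    have D1: "D x + 1 > 0" using D_nonneg[of x] by simp
    have d: "d > 0" using e D1 by (simp add: d_def)
    show "\<exists>d>0. \<forall>x'\<in>UNIV. dist x' x < d \<longrightarrow> dist (P x') (P x) < e"
    proof (intro exI[of _ d] conjI ballI impI d)
      fix y assume "dist y x < d"
      then have y: "dist x y < d" by (simp add: dist_commute)
      have "dist x (c (P y)) \<le> D x + 2 * dist x y"
        using dist_triangle[of x "c (P y)" y] D_le_dist[of y x] by (simp add: D_def dist_commute)
      then have "(dist x (c (P y)))\<^sup>2 \<le> (D x + 2 * dist x y)\<^sup>2"
        by (intro power_mono) auto
      then have "(P x - P y)\<^sup>2 \<le> 2 * ((D x + 2 * dist x y)\<^sup>2 - (D x)\<^sup>2)"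
        by (intro order_trans[OF P_diff_square_le[OF nearest_point_P(1)]]) simp
      also have "\<dots> = 8 * (dist x y * (D x + dist x y))"
        by (simp add: power2_eq_square algebra_simps)
      also have "\<dots> \<le> 8 * (dist x y * (D x + 1))"
        using y D_nonneg[of x] by (intro mult_left_mono) (auto simp: d_def)
      also have "\<dots> < 8 * (d * (D x + 1))"
        using y D1 by simp
      also have "\<dots> \<le> 8 * (e\<^sup>2 / (8 * (D x + 1)) * (D x + 1))"
        using D1 by (intro mult_left_mono mult_right_mono) (auto simp: d_def)
      also have "8 * (e\<^sup>2 / (8 * (D x + 1)) * (D x + 1)) = e\<^sup>2"
      proof -
        have "8 * (e\<^sup>2 / (8 * k) * k) = e\<^sup>2" if "k > 0" for k :: real using that by simp
        from this[OF D1] show ?thesis .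
      qed
      finally have "\<bar>P x - P y\<bar> < e" using e power2_less_imp_less[of "\<bar>P x - P y\<bar>" e]
        by simp
      then show "dist (P y) (P x) < e" by (simp add: dist_real_def abs_minus_commute)
    qed
  qed
qed

text \<open>Compare \<open>\<alpha>\<close> with the piece of the ray joining the projections of its
  endpoints.\<close>

lemma D_affine_geodesic_le:
  assumes "affine_geodesic \<alpha>" "0 \<le> t" "t \<le> 1"
  shows "D (\<alpha> t) \<le> (1 - t) * D (\<alpha> 0) + t * D (\<alpha> 1)"
proof -
  let ?a = "P (\<alpha> 0)" and ?b = "P (\<alpha> 1)"
  note P = nearest_point_P(1)[of "\<alpha> 0"] nearest_point_P(1)[of "\<alpha> 1"]
  have "0 \<le> (1 - t) * ?a + t * ?b" using P assms by simp
  then have "0 \<le> ?a + t * (?b - ?a)" by (simp add: algebra_simps)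
  then have "D (\<alpha> t) \<le> dist (\<alpha> t) (c (?a + t * (?b - ?a)))"
    by (rule D_le)
  also have "\<dots> \<le> (1 - t) * D (\<alpha> 0) + t * D (\<alpha> 1)"
    using affine_geodesics_convex[OF cat0 assms(1) affine_geodesic_ray[OF P] assms(2,3)]
    by (simp add: D_def)
  finally show ?thesis .
qed

lemma convex_on_D_geodesic:
  assumes "geodesic_on {a..b} g"
  shows "convex_on {a..b} (\<lambda>t. D (g t))"
proof (rule convex_onI)
  fix t x y :: real
  assume t: "0 < t" "t < 1" and xy: "x \<in> {a..b}" "y \<in> {a..b}"
  have *: "D (g (u + r * (v - u))) \<le> (1 - r) * D (g u) + r * D (g v)"
    if "u \<le> v" "u \<in> {a..b}" "v \<in> {a..b}" "0 \<le> r" "r \<le> 1" for u v r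
  proof -
    have "geodesic_on {u..v} g" using assms that by (auto intro: geodesic_on_subset)
    from D_affine_geodesic_le[OF affine_geodesic_of_geodesic_on[OF this that(1)] that(4,5)]
    show ?thesis by simp
  qed
  show "D (g ((1 - t) *\<^sub>R x + t *\<^sub>R y)) \<le> (1 - t) * D (g x) + t * D (g y)"
  proof (cases "x \<le> y")
    case True
    have "(1 - t) *\<^sub>R x + t *\<^sub>R y = x + t * (y - x)" by (simp add: algebra_simps)
    with *[of x y t] True xy t show ?thesis by simp
  next
    case False
    have "(1 - t) *\<^sub>R x + t *\<^sub>R y = y + (1 - t) * (x - y)" by (simp add: algebra_simps)
    with *[of y x "1 - t"] False xy t show ?thesis by simp
  qed
qed simp

end

section \<open>Projections along geodesics\<close>

text \<open>Contraction enters as an affine bound of arbitrarily small slope. The condition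
  \<open>dist x y < D x\<close> puts \<open>y\<close> in the largest open ball about
  \<open>x\<close> that misses the ray.\<close>

locale contracting_CAT0_ray = CAT0_ray c for c :: "real \<Rightarrow> 'a::metric_space" +
  assumes contracting:
    "\<theta> > 0 \<Longrightarrow> \<exists>C\<ge>0. \<forall>x y. dist x y < D x \<longrightarrow> \<bar>P x - P y\<bar> \<le> \<theta> * dist x (c 0) + C"
begin

text \<open>Nine uses of contraction bound the shift of projection \<open>R\<close>: eight along the
  geodesic from \<open>g a\<close> to \<open>g u\<close>, and one from \<open>g u\<close> to
  \<open>v\<close>, which projects to \<open>c s\<close>. The bound on \<open>\<theta>\<close> lets
  half of \<open>R\<close> absorb the terms in \<open>\<theta> * R\<close>.\<close>

lemma radius_le_of_contraction:
  assumes contr: "\<And>x y. dist x y < D x \<Longrightarrow> \<bar>P x - P y\<bar> \<le> \<theta> * dist x (c 0) + C"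
    and \<theta>: "\<theta> \<ge> 0" "150 * \<theta> \<le> 1" and "C \<ge> 0"
    and g: "geodesic_on {a..L} g" "a \<le> L"
    and mono: "\<And>t. a \<le> t \<Longrightarrow> t \<le> L \<Longrightarrow> D (g a) \<le> D (g t)"
    and R: "D (g a) = \<bar>P (g a) - P (g L)\<bar>"
  shows "D (g a) \<le> 18 * \<theta> * P (g L) + 18 * C"
proof (cases "D (g a) = 0")
  case True
  then show ?thesis using \<theta> \<open>C \<ge> 0\<close> nearest_point_P(1)[of "g L"] by simp
next
  case False
  define R where "R = D (g a)"
  define s where "s = P (g L)"
  have "R > 0" using False D_nonneg[of "g a"] by (simp add: R_def)
  have "s \<ge> 0" by (simp add: s_def nearest_point_P)
  have R_abs: "R = \<bar>P (g a) - s\<bar>" using R by (simp add: R_def s_def)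
  have wq: "dist (g a) (c s) \<le> 2 * R"
    using dist_triangle[of "g a" "c s" "c (P (g a))"] ray_dist[of "P (g a)" s]
      nearest_point_P(1)[of "g a"] \<open>s \<ge> 0\<close> R_abs R_def by (simp add: D_def)
  \<comment> \<open>If \<open>g L\<close> is within \<open>3 * R\<close> of the ray, the whole
    geodesic is short and its endpoint serves. Otherwise \<open>u\<close> corresponds to the point
    \<open>v\<close> at distance \<open>3 * R\<close> from \<open>c s\<close> on the geodesic from
    \<open>c s\<close> to \<open>g L\<close>.\<close>
  obtain u where u: "a \<le> u" "u \<le> L" "u - a \<le> 7 * R" "\<bar>P (g u) - s\<bar> \<le> \<theta> * (3 * R + s) + C"
  proof (cases "D (g L) \<le> 3 * R")
    case True
    have "L - a = dist (g a) (g L)" using g by (simp add: geodesic_on_def)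
    also have "\<dots> \<le> dist (g a) (c s) + D (g L)"
      using dist_triangle[of "g a" "g L" "c s"] by (simp add: D_def s_def dist_commute)
    finally have "L - a \<le> 7 * R" using wq True \<open>R > 0\<close> by simp
    moreover have "\<bar>P (g L) - s\<bar> \<le> \<theta> * (3 * R + s) + C"
      using \<theta> \<open>C \<ge> 0\<close> \<open>s \<ge> 0\<close> \<open>R > 0\<close> by (simp add: s_def)
    ultimately show thesis using that[of L] g by simp
  next
    case False
    define \<tau> where "\<tau> = 3 * R / D (g L)"
    have DL: "D (g L) > 0" using False \<open>R > 0\<close> by linarith
    have \<tau>: "0 \<le> \<tau>" "\<tau> \<le> 1" using False \<open>R > 0\<close> DL by (auto simp: \<tau>_def)
    have \<tau>D: "\<tau> * D (g L) = 3 * R" using DL by (simp add: \<tau>_def)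
    obtain \<alpha> where \<alpha>: "affine_geodesic \<alpha>" "\<alpha> 0 = c s" "\<alpha> 1 = g L"
      using affine_geodesic_exists[OF cat0] by blast
    have len: "dist (\<alpha> 0) (\<alpha> 1) = D (g L)"
      using \<alpha> by (simp add: D_def s_def dist_commute)
    define v where "v = \<alpha> \<tau>"
    have qv: "dist v (c s) = 3 * R"
      using affine_geodesicD[OF \<alpha>(1), of \<tau> 0] \<tau> \<tau>D \<alpha>(2) unfolding len v_def by simp
    have vy: "dist (g L) v = D (g L) - 3 * R"
    proof -
      have "dist (\<alpha> 1) v = (1 - \<tau>) * D (g L)"
        using affine_geodesicD[OF \<alpha>(1), of 1 \<tau>] \<tau> unfolding len v_def by simp
      then show ?thesis using \<tau>D \<alpha>(3) by (simp add: left_diff_distrib)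
    qed
    \<comment> \<open>Being on a shortest path from \<open>g L\<close> to the ray, \<open>v\<close>
      has the same projection as \<open>g L\<close>.\<close>
    have Dv: "3 * R \<le> D v" using D_le_dist[of "g L" v] vy by simp
    have Pv: "P v = s" by (rule P_eqI) (use \<open>s \<ge> 0\<close> qv Dv in auto)
    define u where "u = a + \<tau> * (L - a)"
    have "0 \<le> \<tau> * (L - a)" "\<tau> * (L - a) \<le> L - a"
      using \<tau> g mult_left_le_one_le[of "L - a" \<tau>] by simp_all
    then have u: "a \<le> u" "u \<le> L" by (auto simp: u_def)
    \<comment> \<open>Thinness at the common parameter \<open>\<tau>\<close> brings
      \<open>g u\<close> within \<open>2 * R\<close> of \<open>v\<close>, inside the ball of radius
      \<open>D v \<ge> 3 * R\<close>.\<close>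
    have "dist (g u) v \<le> (1 - \<tau>) * dist (g a) (c s)"
      using affine_geodesics_common_end[OF cat0 affine_geodesic_of_geodesic_on[OF g] \<alpha>(1) _ \<tau>] \<alpha>
      by (simp add: u_def v_def)
    also have "\<dots> \<le> dist (g a) (c s)"
      using \<tau> by (intro mult_left_le_one_le) auto
    finally have uv: "dist (g u) v \<le> 2 * R" using wq by linarith
    have "dist v (g u) < D v" using uv Dv \<open>R > 0\<close> by (simp add: dist_commute)
    from contr[OF this] have "\<bar>P (g u) - s\<bar> \<le> \<theta> * dist v (c 0) + C"
      using Pv by (simp add: abs_minus_commute)
    moreover have "dist v (c 0) \<le> 3 * R + s"
      using dist_triangle[of v "c 0" "c s"] qv ray_dist[of s 0] \<open>s \<ge> 0\<close> by simp
    then have "\<theta> * dist v (c 0) \<le> \<theta> * (3 * R + s)" using \<theta> by (intro mult_left_mono)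
    moreover have "u - a \<le> 7 * R"
    proof -
      have "u - a = dist (g a) (g u)" using g u by (simp add: geodesic_on_def)
      also have "\<dots> \<le> dist (g a) (c s) + dist v (c s) + dist (g u) v"
        using dist_triangle[of "g a" "g u" "c s"] dist_triangle[of "c s" "g u" v]
        by (simp add: dist_commute)
      finally show ?thesis using wq qv uv by simp
    qed
    ultimately show thesis using that[of u] u by linarith
  qed
  \<comment> \<open>Eight pieces of a length at most \<open>7 * R\<close> are each strictly shorter
    than \<open>R\<close>. As \<open>D\<close> is at least \<open>R\<close> along the geodesic, each
    subdivision point lies in the open contraction ball about its predecessor.\<close>
  define \<delta> where "\<delta> = (u - a) / 8"
  have \<delta>: "8 * \<delta> = u - a" by (simp add: \<delta>_def)
  define w where "w i = g (a + real i * \<delta>)" for i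
  have w_in: "a + real i * \<delta> \<in> {a..u}" if "i \<le> 8" for i
    using u(1) that mult_right_mono[of "real i" 8 \<delta>] \<delta> by simp
  have step: "\<bar>P (w i) - P (w (Suc i))\<bar> \<le> \<theta> * (9 * R + s) + C" if "i < 8" for i
  proof -
    let ?r = "a + real i * \<delta>" and ?r' = "a + real (Suc i) * \<delta>"
    have r: "?r \<in> {a..u}" "?r' \<in> {a..u}" using w_in[of i] w_in[of "Suc i"] that by simp_all
    then have rL: "?r \<in> {a..L}" "?r' \<in> {a..L}" using u(2) by simp_all
    have "dist (w i) (w (Suc i)) = \<bar>?r - ?r'\<bar>"
      using g(1) rL unfolding w_def geodesic_on_def by blast
    also have "?r - ?r' = - \<delta>" by (simp add: distrib_right)
    also have "\<bar>\<dots>\<bar> < R" using u(1,3) \<open>R > 0\<close> \<delta> by simp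
    also have "R \<le> D (w i)" using mono[of ?r] rL by (simp add: R_def w_def)
    finally have "\<bar>P (w i) - P (w (Suc i))\<bar> \<le> \<theta> * dist (w i) (c 0) + C" by (rule contr)
    moreover have "dist (w i) (c 0) \<le> 9 * R + s"
    proof -
      have "dist (w i) (g a) = \<bar>?r - a\<bar>"
        using g rL unfolding w_def geodesic_on_def by (metis atLeastAtMost_iff order_refl)
      also have "\<dots> \<le> 7 * R" using r(1) u(3) by simp
      finally show ?thesis
        using wq ray_dist[of s 0] \<open>s \<ge> 0\<close> dist_triangle[of "w i" "c 0" "g a"]
          dist_triangle[of "g a" "c 0" "c s"] by simp
    qed
    then have "\<theta> * dist (w i) (c 0) \<le> \<theta> * (9 * R + s)" using \<theta> by (intro mult_left_mono)
    ultimately show ?thesis by linarith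
  qed
  have "\<bar>P (w 0) - P (w i)\<bar> \<le> real i * (\<theta> * (9 * R + s) + C)" if "i \<le> 8" for i
    using that
  proof (induction i)
    case (Suc i)
    then have "\<bar>P (w 0) - P (w i)\<bar> \<le> real i * (\<theta> * (9 * R + s) + C)" by simp
    moreover have "\<bar>P (w i) - P (w (Suc i))\<bar> \<le> \<theta> * (9 * R + s) + C"
      using step[of i] Suc by simp
    moreover have "real (Suc i) * K = real i * K + K" for K by (simp add: algebra_simps)
    ultimately show ?case by (smt (verit))
  qed simp
  moreover have "a + real 8 * \<delta> = u" using \<delta> by simp
  then have "w 0 = g a" "w 8 = g u" unfolding w_def by simp_all
  ultimately have "\<bar>P (g a) - P (g u)\<bar> \<le> 8 * (\<theta> * (9 * R + s) + C)"
    by (metis order_refl of_nat_numeral)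
  then have "R \<le> 8 * (\<theta> * (9 * R + s) + C) + (\<theta> * (3 * R + s) + C)"
    using u(4) R_abs by linarith
  also have "\<dots> = 75 * (\<theta> * R) + 9 * (\<theta> * s) + 9 * C" by (simp add: algebra_simps)
  also have "150 * (\<theta> * R) \<le> R"
    using mult_right_mono[OF \<theta>(2), of R] \<open>R > 0\<close> by simp
  then have "75 * (\<theta> * R) \<le> R / 2" by simp
  finally have "R \<le> 18 * (\<theta> * s) + 18 * C" by simp
  then show ?thesis by (simp add: R_def s_def mult.assoc)
qed

text \<open>The point is uniformity: \<open>C\<close> depends on \<open>\<theta>\<close> alone, not
  on the geodesic.\<close>

lemma radius_le:
  assumes "\<theta> > 0"
  obtains C where "C \<ge> 0"
    and "\<And>g a L. geodesic_on {a..L} g \<Longrightarrow> a \<le> L \<Longrightarrow>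
        (\<And>t. a \<le> t \<Longrightarrow> t \<le> L \<Longrightarrow> D (g a) \<le> D (g t)) \<Longrightarrow>
        D (g a) = \<bar>P (g a) - P (g L)\<bar> \<Longrightarrow> D (g a) \<le> \<theta> * P (g L) + C"
proof -
  define \<theta>' where "\<theta>' = min (\<theta> / 18) (1 / 150)"
  have \<theta>': "\<theta>' > 0" "150 * \<theta>' \<le> 1" "18 * \<theta>' \<le> \<theta>" using assms by (auto simp: \<theta>'_def)
  obtain C where C: "C \<ge> 0"
    "\<And>x y. dist x y < D x \<Longrightarrow> \<bar>P x - P y\<bar> \<le> \<theta>' * dist x (c 0) + C"
    using contracting[OF \<theta>'(1)] by blast
  show thesis
  proof (rule that[of "18 * C"])
    fix g a L
    assume *: "geodesic_on {a..L} g" "a \<le> L"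
      "\<And>t. a \<le> t \<Longrightarrow> t \<le> L \<Longrightarrow> D (g a) \<le> D (g t)" "D (g a) = \<bar>P (g a) - P (g L)\<bar>"
    have "D (g a) \<le> 18 * \<theta>' * P (g L) + 18 * C"
      by (rule radius_le_of_contraction[OF C(2) _ \<theta>'(2) C(1) *]) (use \<theta>' in auto)
    also have "18 * \<theta>' * P (g L) \<le> \<theta> * P (g L)"
      using \<theta>' nearest_point_P(1) by (intro mult_right_mono)
    finally show "D (g a) \<le> \<theta> * P (g L) + 18 * C" by simp
  qed (use C in simp)
qed

text \<open>Intermediate value theorem: at \<open>L\<close> the projection difference vanishes while
  \<open>D\<close> is nonnegative, and at \<open>a\<close> the inequality is reversed.\<close>

lemma radius_attained:
  assumes g: "geodesic_on {a..L} g" "a \<le> L" and a: "D (g a) \<le> \<bar>P (g a) - P (g L)\<bar>"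
  obtains t where "a \<le> t" "t \<le> L" "D (g t) = \<bar>P (g t) - P (g L)\<bar>"
proof -
  let ?f = "\<lambda>t. D (g t) - \<bar>P (g t) - P (g L)\<bar>"
  note cont = geodesic_on_continuous[OF g(1)]
  have "continuous_on {a..L} ?f"
    by (intro continuous_intros continuous_on_compose2[OF continuous_on_D cont]
        continuous_on_compose2[OF continuous_on_P cont]) (auto intro: subset_UNIV)
  moreover have "?f a \<le> 0" "0 \<le> ?f L" using a D_nonneg[of "g L"] by auto
  ultimately obtain t where "a \<le> t" "t \<le> L" "?f t = 0"
    using IVT'[of ?f a 0 L] g by blast
  then show thesis using that by simp
qed

text \<open>At the point \<open>b a\<close> where \<open>D\<close> equals the projection difference
  \<open>R\<close>, linear growth of \<open>D\<close> makes \<open>R\<close> at least proportional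
  to \<open>s\<close>, up to a constant. \<open>radius_le\<close> with half that factor then bounds
  \<open>s\<close>.\<close>

lemma projection_bounded:
  assumes b: "geodesic_ray b" and na: "(b, c) \<notin> asymptotic"
  obtains S where "S \<ge> 0" "\<And>t. t \<ge> 0 \<Longrightarrow> P (b t) \<le> S"
proof -
  let ?d = "dist (b 0) (c 0)"
  have b_dist: "dist (b s) (b t) = \<bar>s - t\<bar>" if "0 \<le> s" "0 \<le> t" for s t
    using b that by (simp add: geodesic_ray_def geodesic_on_def)
  have b_on: "geodesic_on {r..s} b" if "0 \<le> r" for r s
    using b that unfolding geodesic_ray_def by (auto intro: geodesic_on_subset)
  \<comment> \<open>If \<open>D\<close> never exceeded its initial value, then
    \<open>P (b t)\<close> would differ from \<open>t\<close> by a bounded amount, and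
    \<open>b\<close> would be asymptotic to \<open>c\<close>.\<close>
  have "\<exists>t1\<ge>0. D (b 0) < D (b t1)"
  proof (rule ccontr)
    assume "\<not> ?thesis"
    then have Db: "D (b t) \<le> D (b 0)" if "t \<ge> 0" for t using that by force
    have "dist (b t) (c t) \<le> 2 * D (b 0) + ?d" if t: "t \<ge> 0" for t
    proof -
      let ?p = "P (b t)"
      have "dist (b t) (c ?p) \<le> D (b 0)" using Db[OF t] by (simp add: D_def)
      moreover have "?p = dist (c ?p) (c 0)" "t = dist (b t) (b 0)"
        using ray_dist[of ?p 0] nearest_point_P(1)[of "b t"] b_dist[of t 0] t by auto
      then have "\<bar>?p - t\<bar> \<le> dist (b t) (c ?p) + ?d"
        using dist_triangle[of "c ?p" "c 0" "b t"] dist_triangle[of "b t" "c 0" "b 0"]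
          dist_triangle[of "b t" "b 0" "c ?p"] dist_triangle[of "c ?p" "b 0" "c 0"]
        by (simp add: dist_commute abs_le_iff)
      moreover have "dist (c ?p) (c t) = \<bar>?p - t\<bar>"
        using ray_dist nearest_point_P(1) t by blast
      ultimately show ?thesis using dist_triangle[of "b t" "c t" "c ?p"] by linarith
    qed
    then have "(b, c) \<in> asymptotic" using b ray unfolding asymptotic_def by blast
    with na show False ..
  qed
  then obtain t1 where t1: "t1 \<ge> 0" "D (b 0) < D (b t1)" by blast
  then have "t1 > 0" by (cases "t1 = 0") auto
  have mono: "D (b u) \<le> D (b v)" if "t1 \<le> u" "u \<le> v" for u v
  proof (rule convex_on_mono_after_start[OF convex_on_D_geodesic[OF b_on[of 0 v]]])
    have "D (b t1) \<le> D (b u)"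
      by (rule convex_on_mono_after_start[OF convex_on_D_geodesic[OF b_on[of 0 u]]])
        (use \<open>t1 > 0\<close> that t1 in auto)
    then show "D (b 0) \<le> D (b u)" using t1 by simp
  qed (use \<open>t1 > 0\<close> that in auto)
  \<comment> \<open>The slope of the chord of \<open>D\<close> over \<open>{0..t1}\<close>; by
    convexity \<open>D\<close> grows at least this fast afterwards.\<close>
  define \<epsilon> where "\<epsilon> = (D (b t1) - D (b 0)) / t1"
  have "\<epsilon> > 0" using t1 \<open>t1 > 0\<close> by (simp add: \<epsilon>_def)
  have growth: "\<epsilon> * t \<le> D (b t)" if "t \<ge> t1" for t
  proof -
    have "(t - 0) * D (b t1) \<le> (t - t1) * D (b 0) + (t1 - 0) * D (b t)"
      by (rule convex_on_three_points[OF convex_on_D_geodesic[OF b_on[of 0 t]]])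
        (use that t1 in auto)
    then have "t * (D (b t1) - D (b 0)) \<le> t1 * (D (b t) - D (b 0))"
      by (simp add: algebra_simps)
    also have "\<dots> \<le> t1 * D (b t)" using t1 D_nonneg[of "b 0"] by (intro mult_left_mono) auto
    finally show ?thesis using \<open>t1 > 0\<close> by (simp add: \<epsilon>_def pos_divide_le_eq mult.commute)
  qed
  \<comment> \<open>Chosen so that the argument below yields
    \<open>e * (s - ?d) \<le> R\<close>.\<close>
  define e where "e = \<epsilon> / (1 + 2 * \<epsilon>)"
  have "e > 0" using \<open>\<epsilon> > 0\<close> by (simp add: e_def)
  have "e / 2 > 0" using \<open>e > 0\<close> by simp
  obtain C where C: "C \<ge> 0"
    "\<And>g a L. geodesic_on {a..L} g \<Longrightarrow> a \<le> L \<Longrightarrow>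
        (\<And>t. a \<le> t \<Longrightarrow> t \<le> L \<Longrightarrow> D (g a) \<le> D (g t)) \<Longrightarrow>
        D (g a) = \<bar>P (g a) - P (g L)\<bar> \<Longrightarrow> D (g a) \<le> e / 2 * P (g L) + C"
    using radius_le[OF \<open>e / 2 > 0\<close>] by blast
  \<comment> \<open>One entry for each case below: \<open>T\<close> before \<open>t1\<close>,
    projection at most \<open>D (b t1)\<close> past that of \<open>b t1\<close>, and projection
    beyond that.\<close>
  define S where "S = Max {2 * (t1 + ?d), P (b t1) + D (b t1), 2 * (C + e * ?d) / e}"
  have S: "2 * (t1 + ?d) \<le> S" "P (b t1) + D (b t1) \<le> S" "2 * (C + e * ?d) / e \<le> S"
    by (auto simp: S_def)
  show thesis
  proof (rule that[of S])
    show "S \<ge> 0" using S(1) t1 by (smt (verit) zero_le_dist)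
    fix T :: real assume T: "T \<ge> 0"
    define s where "s = P (b T)"
    have "s \<ge> 0" by (simp add: s_def nearest_point_P)
    consider "T < t1" | "T \<ge> t1" "s \<le> P (b t1) + D (b t1)"
      | "T \<ge> t1" "s > P (b t1) + D (b t1)" by linarith
    then show "P (b T) \<le> S"
    proof cases
      case 1
      have "s \<le> D (b T) + dist (b T) (c 0)"
        using dist_triangle[of "c s" "c 0" "b T"] ray_dist[of s 0] \<open>s \<ge> 0\<close>
        by (simp add: D_def s_def dist_commute)
      moreover have "D (b T) \<le> dist (b T) (c 0)" by (rule D_le) simp
      moreover have "dist (b T) (c 0) \<le> T + ?d"
        using dist_triangle[of "b T" "c 0" "b 0"] b_dist[of T 0] T by simp
      ultimately show ?thesis using 1 S(1) by (simp add: s_def)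
    next
      case 2
      then show ?thesis using S(2) by (simp add: s_def)
    next
      case 3
      have "D (b t1) \<le> \<bar>P (b t1) - P (b T)\<bar>" using 3 by (simp add: s_def)
      from radius_attained[OF b_on[OF t1(1)] 3(1) this]
      obtain a where a: "t1 \<le> a" "a \<le> T" "D (b a) = \<bar>P (b a) - P (b T)\<bar>" by blast
      define R where "R = D (b a)"
      have "R \<le> e / 2 * s + C"
        unfolding R_def s_def
      proof (rule C(2)[OF b_on])
        show "D (b a) \<le> D (b t)" if "a \<le> t" for t by (rule mono[OF a(1) that])
      qed (use a t1 in auto)
      have "s \<le> 2 * R + a + ?d"
      proof -
        have "s = dist (c s) (c 0)" using ray_dist[of s 0] \<open>s \<ge> 0\<close> by simp
        also have "\<dots> \<le> dist (c s) (c (P (b a))) + dist (c (P (b a))) (b a) + dist (b a) (b 0) + ?d"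
          by (smt (verit) dist_triangle)
        also have "dist (c s) (c (P (b a))) = R"
          using ray_dist[OF \<open>s \<ge> 0\<close> nearest_point_P(1)[of "b a"]] a(3)
          by (simp add: R_def s_def abs_minus_commute)
        also have "dist (c (P (b a))) (b a) = R" by (simp add: R_def D_def dist_commute)
        also have "dist (b a) (b 0) = a" using b_dist[of a 0] a t1 by simp
        finally show ?thesis by simp
      qed
      \<comment> \<open>The growth of \<open>D\<close> trades the time \<open>a\<close> for
        \<open>R\<close>, leaving \<open>s\<close> bounded by a multiple of \<open>R\<close> plus
        \<open>?d\<close>.\<close>
      then have "\<epsilon> * (s - 2 * R - ?d) \<le> \<epsilon> * a" using \<open>\<epsilon> > 0\<close> by (intro mult_left_mono) auto
      also have "\<dots> \<le> R" using growth[OF a(1)] by (simp add: R_def)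
      finally have "\<epsilon> * (s - ?d) \<le> R * (1 + 2 * \<epsilon>)" by (simp add: algebra_simps)
      then have "e * (s - ?d) \<le> R" using \<open>\<epsilon> > 0\<close> by (simp add: e_def pos_divide_le_eq)
      with \<open>R \<le> e / 2 * s + C\<close> have "e * s / 2 \<le> C + e * ?d" by (simp add: algebra_simps)
      then have "s \<le> 2 * (C + e * ?d) / e" using \<open>e > 0\<close> by (simp add: pos_le_divide_eq mult.commute)
      then show ?thesis using S(3) by (simp add: s_def)
    qed
  qed
qed

text \<open>A geodesic starting on the ray has \<open>D = 0\<close> there, so \<open>D\<close> is
  nondecreasing along it by convexity. \<open>radius_le\<close> therefore applies at any crossing
  point and bounds its radius independently of the geodesic.\<close>

lemma geodesics_pass_near_start:
  assumes "S \<ge> 0"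
  obtains R where "R \<ge> 0"
    "\<And>g L. geodesic_on {0..L} g \<Longrightarrow> 0 \<le> L \<Longrightarrow> g 0 \<in> c ` {0..} \<Longrightarrow> P (g L) \<le> S \<Longrightarrow>
       \<exists>t. 0 \<le> t \<and> t \<le> L \<and> dist (g t) (c 0) \<le> R"
proof -
  obtain C where C: "C \<ge> 0"
    "\<And>g a L. geodesic_on {a..L} g \<Longrightarrow> a \<le> L \<Longrightarrow>
        (\<And>t. a \<le> t \<Longrightarrow> t \<le> L \<Longrightarrow> D (g a) \<le> D (g t)) \<Longrightarrow>
        D (g a) = \<bar>P (g a) - P (g L)\<bar> \<Longrightarrow> D (g a) \<le> 1 * P (g L) + C"
    using radius_le[of 1] by auto
  show thesis
  \<comment> \<open>Three legs to \<open>c 0\<close>: down to the ray and along it to the projection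
    of the endpoint, each at most \<open>S + C\<close>, then at most \<open>S\<close> to the
    start.\<close>
  proof (rule that[of "2 * (S + C) + S"])
    show "2 * (S + C) + S \<ge> 0" using assms C by simp
    fix g L
    assume g: "geodesic_on {0..L} g" "0 \<le> L" and g0: "g 0 \<in> c ` {0..}" and PS: "P (g L) \<le> S"
    obtain r where "0 \<le> r" "g 0 = c r" using g0 by auto
    then have D0: "D (g 0) = 0" using P_ray[of r] by (simp add: D_def)
    have mono: "D (g u) \<le> D (g v)" if "0 \<le> u" "u \<le> v" "v \<le> L" for u v
    proof (cases "u = 0")
      case False
      then show ?thesis
        using convex_on_mono_after_start[OF convex_on_D_geodesic[OF g(1)], of u v] that D0 D_nonneg
        by simp
    qed (simp add: D0 D_nonneg)
    obtain a where a: "0 \<le> a" "a \<le> L" "D (g a) = \<bar>P (g a) - P (g L)\<bar>"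
      using radius_attained[OF g] D0 by auto
    have "geodesic_on {a..L} g" using g a by (auto intro: geodesic_on_subset)
    from C(2)[OF this a(2) _ a(3)] mono a PS have R: "D (g a) \<le> S + C" by fastforce
    let ?s = "P (g L)" and ?p = "P (g a)"
    have "dist (g a) (c 0) \<le> dist (g a) (c ?p) + dist (c ?p) (c ?s) + dist (c ?s) (c 0)"
      by (smt (verit) dist_triangle)
    also have "\<dots> \<le> (S + C) + (S + C) + S"
      using R a(3) PS ray_dist nearest_point_P(1)[of "g L"] nearest_point_P(1)[of "g a"]
      by (simp add: D_def)
    finally show "\<exists>t. 0 \<le> t \<and> t \<le> L \<and> dist (g t) (c 0) \<le> 2 * (S + C) + S"
      using a by auto
  qed
qed

end

section \<open>Limits of geodesics\<close>

text \<open>One copy of the initial distance pays for comparison at proportional parameters, the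
  other for returning to arc length, since the lengths \<open>A\<close> and \<open>B\<close> differ
  by at most that distance.\<close>

lemma geodesics_common_end_fellow_travel:
  fixes g h :: "real \<Rightarrow> 'a::metric_space"
  assumes cat0: "CAT0_space TYPE('a)"
    and g: "geodesic_on {0..A} g" and h: "geodesic_on {0..B} h" and end_eq: "g A = h B"
    and t: "0 \<le> t" "t \<le> A" "t \<le> B"
  shows "dist (g t) (h t) \<le> 2 * dist (g 0) (h 0)"
proof (cases "A = 0")
  case True
  with t show ?thesis by simp
next
  case False
  then have "A > 0" using t by simp
  have AB: "\<bar>B - A\<bar> \<le> dist (g 0) (h 0)"
  proof -
    have "dist (g 0) (g A) = A" "dist (h 0) (h B) = B"
      using g h t unfolding geodesic_on_def by simp_all
    then have "A = dist (g 0) (h B)" "B = dist (h 0) (h B)" by (simp_all add: end_eq)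
    then show ?thesis
      using dist_triangle[of "g 0" "h B" "h 0"] dist_triangle[of "h 0" "h B" "g 0"]
      by (simp add: abs_le_iff dist_commute)
  qed
  define \<tau> where "\<tau> = t / A"
  have \<tau>: "0 \<le> \<tau>" "\<tau> \<le> 1" using t \<open>A > 0\<close> by (auto simp: \<tau>_def)
  have \<tau>A: "\<tau> * A = t" using \<open>A > 0\<close> by (simp add: \<tau>_def)
  have AB0: "0 \<le> A" "0 \<le> B" using t by auto
  have "dist (g t) (h (\<tau> * B)) \<le> (1 - \<tau>) * dist (g 0) (h 0)"
    using affine_geodesics_common_end[OF cat0 affine_geodesic_of_geodesic_on[OF g AB0(1)]
        affine_geodesic_of_geodesic_on[OF h AB0(2)] _ \<tau>] end_eq \<tau>A by simp
  also have "\<dots> \<le> dist (g 0) (h 0)"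
    using \<tau> by (intro mult_left_le_one_le) auto
  finally have "dist (g t) (h (\<tau> * B)) \<le> dist (g 0) (h 0)" .
  moreover have "dist (h (\<tau> * B)) (h t) \<le> dist (g 0) (h 0)"
  proof -
    have "\<tau> * B \<in> {0..B}" using \<tau> AB0 by (simp add: mult_left_le_one_le)
    then have "dist (h (\<tau> * B)) (h t) = \<bar>\<tau> * B - \<tau> * A\<bar>"
      using h t \<tau>A unfolding geodesic_on_def by simp
    also have "\<dots> = \<tau> * \<bar>B - A\<bar>"
      using \<tau> by (simp add: abs_mult flip: right_diff_distrib)
    also have "\<dots> \<le> \<bar>B - A\<bar>" using \<tau> by (intro mult_left_le_one_le) auto
    finally show ?thesis using AB by simp
  qed
  ultimately show ?thesis using dist_triangle[of "g t" "h t" "h (\<tau> * B)"] by simp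
qed

text \<open>Each distance condition involves only two coordinates, hence is closed in the product
  topology.\<close>

lemma closed_geodesic_on:
  "closed {g :: real \<Rightarrow> 'a::metric_space. geodesic_on I g}"
proof -
  have "closed {g :: real \<Rightarrow> 'a. dist (g s) (g t) = \<bar>s - t\<bar>}" for s t
    by (intro closed_Collect_eq continuous_on_dist continuous_on_product_coordinates continuous_on_const)
  then have "closed (\<Inter>s\<in>I. \<Inter>t\<in>I. {g :: real \<Rightarrow> 'a. dist (g s) (g t) = \<bar>s - t\<bar>})"
    by (intro closed_INT ballI)
  also have "(\<Inter>s\<in>I. \<Inter>t\<in>I. {g :: real \<Rightarrow> 'a. dist (g s) (g t) = \<bar>s - t\<bar>}) = {g. geodesic_on I g}"
    by (auto simp: geodesic_on_def)
  finally show ?thesis .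
qed

text \<open>Tychonoff's theorem replaces the usual Arzela-Ascoli argument: being geodesic on a set is
  closed in the topology of pointwise convergence.\<close>

lemma geodesic_line_limit:
  fixes f :: "real \<Rightarrow> 'a::metric_space"
  assumes proper: "proper_space TYPE('a)"
    and approx: "\<And>n::nat. \<exists>g. geodesic_on {- real n..real n} g \<and>
        (\<forall>t\<in>{- real n..real n}. dist (f t) (g t) \<le> K)"
  obtains l where "geodesic_line l" "\<And>t. dist (f t) (l t) \<le> K"
proof -
  have "dist (f 0) (g 0) \<le> K \<Longrightarrow> 0 \<le> K" for g :: "real \<Rightarrow> 'a"
    by (rule order_trans[OF zero_le_dist])
  then have "K \<ge> 0" using approx[of 0] by fastforce
  define \<F> where "\<F> n = {g :: real \<Rightarrow> 'a. geodesic_on {- real n..real n} g}" for n :: nat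
  let ?S = "PiE UNIV (\<lambda>t. cball (f t) K)"
  have "compactin (product_topology (\<lambda>_. euclidean) UNIV) ?S"
    unfolding compactin_PiE using proper by (auto simp: proper_space_def)
  then have "compact ?S" unfolding euclidean_product_topology by simp
  then have "?S \<inter> (\<Inter>n\<in>UNIV. \<F> n) \<noteq> {}"
  proof (rule compact_imp_fip_image)
    show "closed (\<F> n)" for n unfolding \<F>_def by (rule closed_geodesic_on)
    fix I :: "nat set" assume "finite I"
    then obtain n where n: "\<And>i. i \<in> I \<Longrightarrow> i \<le> n"
      using finite_nat_set_iff_bounded_le by auto
    obtain g where g: "geodesic_on {- real n..real n} g"
      "\<And>t. t \<in> {- real n..real n} \<Longrightarrow> dist (f t) (g t) \<le> K"
      using approx[of n] by blast
    \<comment> \<open>Filling in with \<open>f\<close> outside the interval puts the map in the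
      product of balls at every parameter; this uses \<open>K \<ge> 0\<close>.\<close>
    define g' where "g' t = (if t \<in> {- real n..real n} then g t else f t)" for t
    have "geodesic_on {- real n..real n} g'"
      using g(1) by (simp add: geodesic_on_def g'_def)
    then have "g' \<in> \<F> i" if "i \<in> I" for i
      using n[OF that] unfolding \<F>_def by (auto intro: geodesic_on_subset)
    moreover have "g' \<in> ?S"
      using g(2) \<open>K \<ge> 0\<close> by (auto simp: g'_def PiE_iff)
    ultimately show "?S \<inter> (\<Inter>n\<in>I. \<F> n) \<noteq> {}" by blast
  qed
  then obtain l where l: "l \<in> ?S" "\<And>n. l \<in> \<F> n" by blast
  have "geodesic_line l"
    unfolding geodesic_line_def geodesic_on_def
  proof (intro ballI)
    fix s t :: real
    obtain n :: nat where "max \<bar>s\<bar> \<bar>t\<bar> \<le> real n" using real_arch_simple by blast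
    then have "s \<in> {- real n..real n}" "t \<in> {- real n..real n}" by auto
    then show "dist (l s) (l t) = \<bar>s - t\<bar>"
      using l(2)[of n] unfolding \<F>_def geodesic_on_def by blast
  qed
  moreover have "dist (f t) (l t) \<le> K" for t using l(1) by (auto simp: PiE_iff)
  ultimately show thesis by (rule that)
qed

section \<open>From the contraction hypothesis to the line\<close>

lemma (in CAT0_ray) contracting_rayD:
  assumes "contracting_ray \<kappa> c"
  obtains n where "n \<ge> 0" "\<And>x y. dist x y < D x \<Longrightarrow> \<bar>P x - P y\<bar> \<le> n * \<kappa> (dist x (c 0))"
proof -
  obtain n where n: "n \<ge> 0" "\<And>x r. ball x r \<inter> c ` {0..} = {} \<Longrightarrow>
      diameter (nearest_point (c ` {0..}) ` ball x r) \<le> n * \<kappa> (dist x (c 0))"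
    using assms unfolding contracting_ray_def by blast
  have "\<bar>P x - P y\<bar> \<le> n * \<kappa> (dist x (c 0))" if "dist x y < D x" for x y
  proof -
    let ?A = "nearest_point (c ` {0..}) ` ball x (D x)"
    have "ball x (D x) \<inter> c ` {0..} = {}"
      using D_le[of _ x] by force
    then have "diameter ?A \<le> n * \<kappa> (dist x (c 0))" by (rule n(2))
    \<comment> \<open>\<open>diameter\<close> bounds distances only in a bounded set; a crude bound
      through \<open>c 0\<close> is enough.\<close>
    moreover have "bounded ?A"
    proof -
      have "dist (c 0) p \<le> 2 * (dist x (c 0) + D x)" if p: "p \<in> ?A" for p
      proof -
        obtain z where z: "dist x z < D x" "p = c (P z)"
          using p nearest_point_P(2) by auto
        have "dist (c 0) p \<le> 2 * dist z (c 0)"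
          using dist_triangle[of "c 0" "c (P z)" z] D_le[of 0 z] z by (simp add: D_def dist_commute)
        also have "dist z (c 0) \<le> dist x (c 0) + D x"
          using dist_triangle[of z "c 0" x] z by (simp add: dist_commute)
        finally show ?thesis by simp
      qed
      then show ?thesis unfolding bounded_def by blast
    qed
    moreover have "c (P x) \<in> ?A" "c (P y) \<in> ?A"
      using that order_le_less_trans[OF zero_le_dist that] nearest_point_P(2) by auto
    ultimately have "dist (c (P x)) (c (P y)) \<le> n * \<kappa> (dist x (c 0))"
      using diameter_bounded_bound order_trans by blast
    then show ?thesis using ray_dist nearest_point_P(1) by simp
  qed
  with n show thesis using that by blast
qed

lemma (in contracting_CAT0_ray) line_asymptotic_to_both:
  assumes proper: "proper_space TYPE('a)"
    and b: "geodesic_ray b" and na: "(b, c) \<notin> asymptotic"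
  obtains l where "geodesic_line l" "((\<lambda>t. l (- t)), c) \<in> asymptotic" "(l, b) \<in> asymptotic"
proof -
  obtain S where S: "S \<ge> 0" "\<And>t. t \<ge> 0 \<Longrightarrow> P (b t) \<le> S"
    using projection_bounded[OF b na] by blast
  obtain R where R: "R \<ge> 0"
    "\<And>g L. geodesic_on {0..L} g \<Longrightarrow> 0 \<le> L \<Longrightarrow> g 0 \<in> c ` {0..} \<Longrightarrow> P (g L) \<le> S \<Longrightarrow>
       \<exists>t. 0 \<le> t \<and> t \<le> L \<and> dist (g t) (c 0) \<le> R"
    using geodesics_pass_near_start[OF S(1)] by blast
  let ?d = "dist (b 0) (c 0)"
  \<comment> \<open>The reversed \<open>c\<close> followed by \<open>b\<close>. It may jump at 0,
    which is harmless since only pointwise closeness to \<open>f\<close> is required.\<close>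
  define f where "f t = (if t < 0 then c (- t) else b t)" for t
  obtain l where l: "geodesic_line l" "\<And>t. dist (f t) (l t) \<le> 2 * (R + ?d)"
  proof (rule geodesic_line_limit[OF proper])
    fix n :: nat
    \<comment> \<open>Far enough out that the point \<open>\<gamma> a\<close> near
      \<open>c 0\<close> leaves length at least \<open>n\<close> on either side of it.\<close>
    define N where "N = real n + R + ?d"
    have N: "N \<ge> 0" "real n \<le> N" using R by (auto simp: N_def)
    let ?L = "dist (c N) (b N)"
    obtain A where "geodesic_segment (c N) (b N) A"
      using cat0 unfolding CAT0_space_def by blast
    then obtain \<gamma> where \<gamma>: "geodesic_on {0..?L} \<gamma>" "\<gamma> 0 = c N" "\<gamma> ?L = b N"
      unfolding geodesic_segment_def by blast
    have "P (\<gamma> ?L) \<le> S" using S(2) N \<gamma> by simp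
    then obtain a where a: "0 \<le> a" "a \<le> ?L" "dist (\<gamma> a) (c 0) \<le> R"
      using R(2)[OF \<gamma>(1)] \<gamma>(2) N by auto
    have ab: "dist (\<gamma> a) (b 0) \<le> R + ?d"
      using dist_triangle[of "\<gamma> a" "b 0" "c 0"] a by (simp add: dist_commute)
    have na: "real n \<le> a"
    proof -
      have "N = dist (c N) (c 0)" using ray_dist[of N 0] N by simp
      also have "\<dots> \<le> dist (\<gamma> 0) (\<gamma> a) + dist (\<gamma> a) (c 0)"
        using dist_triangle \<gamma>(2) by metis
      also have "dist (\<gamma> 0) (\<gamma> a) = a" using \<gamma>(1) a unfolding geodesic_on_def by simp
      finally show ?thesis using a(3) zero_le_dist[of "b 0" "c 0"] unfolding N_def by linarith
    qed
    have nL: "real n \<le> ?L - a"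
    proof -
      have "N = dist (b N) (b 0)" using b N unfolding geodesic_ray_def geodesic_on_def by simp
      also have "\<dots> \<le> dist (\<gamma> ?L) (\<gamma> a) + dist (\<gamma> a) (b 0)"
        using dist_triangle \<gamma>(3) by metis
      also have "dist (\<gamma> ?L) (\<gamma> a) = ?L - a" using \<gamma>(1) a unfolding geodesic_on_def by simp
      finally show ?thesis using ab unfolding N_def by linarith
    qed
    have \<gamma>_dist: "dist (\<gamma> s) (\<gamma> t) = \<bar>s - t\<bar>" if "0 \<le> s" "s \<le> ?L" "0 \<le> t" "t \<le> ?L" for s t
      using \<gamma>(1) that unfolding geodesic_on_def by auto
    \<comment> \<open>Each half of \<open>\<gamma>\<close>, started at \<open>\<gamma> a\<close>,
      shares its far end with the corresponding ray, so the two fellow-travel.\<close>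
    have fwd: "dist (\<gamma> (a + t)) (b t) \<le> 2 * (R + ?d)" if "0 \<le> t" "t \<le> real n" for t
    proof -
      have g: "geodesic_on {0..?L - a} (\<lambda>t. \<gamma> (a + t))"
        unfolding geodesic_on_def using a by (auto simp: \<gamma>_dist)
      have h: "geodesic_on {0..N} b"
        using b unfolding geodesic_ray_def by (auto intro: geodesic_on_subset)
      have "dist (\<gamma> (a + t)) (b t) \<le> 2 * dist (\<gamma> (a + 0)) (b 0)"
        using geodesics_common_end_fellow_travel[OF cat0 g h, of t] that nL N \<gamma>(3) by simp
      then show ?thesis using ab by simp
    qed
    have bwd: "dist (\<gamma> (a - t)) (c t) \<le> 2 * (R + ?d)" if "0 \<le> t" "t \<le> real n" for t
    proof -
      have g: "geodesic_on {0..a} (\<lambda>t. \<gamma> (a - t))"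
        unfolding geodesic_on_def using a by (auto simp: \<gamma>_dist)
      have h: "geodesic_on {0..N} c"
        using ray unfolding geodesic_ray_def by (auto intro: geodesic_on_subset)
      have "dist (\<gamma> (a - t)) (c t) \<le> 2 * dist (\<gamma> (a - 0)) (c 0)"
        using geodesics_common_end_fellow_travel[OF cat0 g h, of t] that na N \<gamma>(2) by simp
      also have "dist (\<gamma> (a - 0)) (c 0) \<le> R + ?d"
        using a(3) zero_le_dist[of "b 0" "c 0"] by (simp del: zero_le_dist)
      finally show ?thesis by simp
    qed
    have "geodesic_on {- real n..real n} (\<lambda>t. \<gamma> (a + t))"
      unfolding geodesic_on_def using na nL by (auto simp: \<gamma>_dist)
    moreover have "dist (f t) (\<gamma> (a + t)) \<le> 2 * (R + ?d)" if "t \<in> {- real n..real n}" for t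
      using fwd[of t] bwd[of "- t"] that by (auto simp: f_def dist_commute)
    ultimately show "\<exists>g. geodesic_on {- real n..real n} g \<and>
        (\<forall>t\<in>{- real n..real n}. dist (f t) (g t) \<le> 2 * (R + ?d))"
      by blast
  qed blast
  have rays: "geodesic_ray l" "geodesic_ray (\<lambda>t. l (- t))"
    using l(1) by (auto simp: geodesic_line_def geodesic_ray_def geodesic_on_def)
  have "dist (l t) (b t) \<le> 2 * (R + ?d)" if "t \<ge> 0" for t
    using l(2)[of t] that by (simp add: f_def dist_commute)
  then have "(l, b) \<in> asymptotic" using rays b unfolding asymptotic_def by blast
  \<comment> \<open>At \<open>t = 0\<close> the map \<open>f\<close> takes its value from
    \<open>b\<close>, which costs the extra distance between the two starting points.\<close>
  moreover have "dist (l (- t)) (c t) \<le> 2 * (R + ?d) + dist (b 0) (c 0)" if "t \<ge> 0" for t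
  proof (cases "t = 0")
    case True
    then show ?thesis
      using l(2)[of 0] dist_triangle[of "l 0" "c 0" "b 0"] by (simp add: f_def dist_commute)
  next
    case False
    then have "dist (l (- t)) (c t) \<le> 2 * (R + ?d)"
      using l(2)[of "- t"] that by (simp add: f_def dist_commute)
    then show ?thesis by (smt (verit) zero_le_dist)
  qed
  then have "((\<lambda>t. l (- t)), c) \<in> asymptotic" using rays ray unfolding asymptotic_def by blast
  ultimately show thesis using that l(1) by blast
qed

text \<open>The affine bounds on \<open>n * \<kappa>\<close> convert the diameter condition into the
  contraction assumption of the locale.\<close>

lemma sublinearly_contracting_imp_contracting_CAT0_ray:
  fixes c :: "real \<Rightarrow> 'a::metric_space"
  assumes "CAT0_space TYPE('a)" "sublinearly_contracting_ray c"
  shows "contracting_CAT0_ray c"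
proof -
  from assms obtain \<kappa> where c: "geodesic_ray c" and \<kappa>: "sublinear_function \<kappa>" "contracting_ray \<kappa> c"
    unfolding sublinearly_contracting_ray_def by blast
  interpret CAT0_ray c by unfold_locales (use assms(1) c in auto)
  obtain n where n: "n \<ge> 0" "\<And>x y. dist x y < D x \<Longrightarrow> \<bar>P x - P y\<bar> \<le> n * \<kappa> (dist x (c 0))"
    using contracting_rayD[OF \<kappa>(2)] by blast
  show ?thesis
  proof unfold_locales
    fix \<theta> :: real assume "\<theta> > 0"
    then obtain C where C: "C \<ge> 0" "\<And>t. t \<ge> 0 \<Longrightarrow> n * \<kappa> t \<le> \<theta> * t + C"
      using sublinear_affine_bound[OF \<kappa>(1) n(1)] by blast
    then show "\<exists>C\<ge>0. \<forall>x y. dist x y < D x \<longrightarrow> \<bar>P x - P y\<bar> \<le> \<theta> * dist x (c 0) + C"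
      using n(2) by (meson order_trans zero_le_dist)
  qed
qed

lemma endpoint_eqI: "(b, c) \<in> asymptotic \<Longrightarrow> endpoint b = endpoint c"
  unfolding endpoint_def by (rule equiv_class_eq[OF equiv_asymptotic])

theorem corollary2:
  fixes c :: "real \<Rightarrow> 'a::metric_space"
    and \<zeta> :: "(real \<Rightarrow> 'a) set"
  assumes "proper_space TYPE('a)"
    and "CAT0_space TYPE('a)"
    and "sublinearly_contracting_ray c"
    and "\<zeta> = endpoint c"
  shows "(\<forall>\<eta>\<in>visual_boundary. \<zeta> \<noteq> \<eta> \<longrightarrow>
            (\<exists>l. geodesic_line l \<and> endpoint (\<lambda>t. l (- t)) = \<zeta> \<and> endpoint l = \<eta>))
         \<and> visibility_point \<zeta>"
proof -
  interpret contracting_CAT0_ray c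
    by (rule sublinearly_contracting_imp_contracting_CAT0_ray) (use assms in auto)
  have lines: "\<exists>l. geodesic_line l \<and> endpoint (\<lambda>t. l (- t)) = \<zeta> \<and> endpoint l = \<eta>"
    if "\<eta> \<in> visual_boundary" "\<zeta> \<noteq> \<eta>" for \<eta>
  proof -
    obtain b where b: "geodesic_ray b" "\<eta> = endpoint b"
      using \<open>\<eta> \<in> visual_boundary\<close> unfolding visual_boundary_def endpoint_def
      by (auto elim: quotientE)
    then have "(b, c) \<notin> asymptotic" using endpoint_eqI \<open>\<zeta> \<noteq> \<eta>\<close> assms(4) by blast
    from line_asymptotic_to_both[OF assms(1) b(1) this] show ?thesis
      using endpoint_eqI b(2) assms(4) by metis
  qed
  moreover have "\<zeta> \<in> visual_boundary"
    unfolding visual_boundary_def assms(4) endpoint_def using ray by (intro quotientI) simp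
  ultimately show ?thesis
    unfolding visibility_point_def line_joins_def by metis
qed

end
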